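(* Let $X$ be a real normed space, let $K,M\subset X$ be convex bodies with $\delta(K,M)<\frac12 w(K)$, and let $\mathbf{x},\mathbf{y}\in X$. Then $$\big|\alpha(K,\mathbf{x})-\alpha(M,\mathbf{y})\big|\le\frac{\delta(K,M)\big(4\|\mathbf{y}\|+4D(K)+2w(K)\big)}{w(K)\big(w(K)-2\delta(K,M)\big)}+\frac{2\|\mathbf{x}-\mathbf{y}\|}{w(K)}.$$
   Context: $X$ is a real normed space, $X\neq\{0\}$; $X^*$ is its dual and $S^*$ the unit sphere of $X^*$. A convex body is a bounded, closed, convex set with nonempty interior. The support function of $K$ is $h(K,\mathbf{v}^* )=\sup_{\mathbf{x}\in K}\langle \mathbf{v}^*,\mathbf{x}\rangle$; $w(K,\mathbf{v}^* )=h(K,\mathbf{v}^* )+h(K,-\mathbf{v}^* )$; the width of $K$ is $w(K)=\inf_{\mathbf{v}^*\in S^*}w(K,\mathbf{v}^* )$; and $D(K)=\sup_{\mathbf{x}\in K}\|\mathbf{x}\|$. The Hausdorff distance is $\delta(K,M)=\max\{\sup_{\mathbf{x}\in K}\inf_{\mathbf{y}\in M}\|\mathbf{x}-\mathbf{y}\|,\ \sup_{\mathbf{y}\in M}\inf_{\mathbf{x}\in K}\|\mathbf{x}-\mathbf{y}\|\}$. For $\lambda\ge 0$ and $\mathbf{v}^*\in S^*$, with $r=-h(K,-\mathbf{v}^* )$ and $s=h(K,\mathbf{v}^* )$, set $$L^\lambda(K,\mathbf{v}^* )=\left\{\mathbf{x}\in X:\ \tfrac{\lambda+1}{2}r-\tfrac{\lambda-1}{2}s\le\langle\mathbf{v}^*,\mathbf{x}\rangle\le\tfrac{\lambda+1}{2}s-\tfrac{\lambda-1}{2}r\right\},\qquad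 K^\lambda=\bigcap_{\mathbf{v}^*\in S^*}L^\lambda(K,\mathbf{v}^* ).$$ The generalized Minkowski functional is $\alpha(K,\mathbf{x})=\inf\{\lambda\ge0:\mathbf{x}\in K^\lambda\}$, which is finite for every $\mathbf{x}\in X$. *)

theory Defs
  imports "HOL-Analysis.Analysis"
begin

text \<open>
  The normed space \<open>X\<close> is a type of class \<open>real_normed_vector\<close> (no completeness or finite
  dimension), and its dual is the type \<open>'a \<Rightarrow>\<^sub>L real\<close> with the operator norm, so that the dual
  unit sphere is \<open>sphere 0 1\<close>.

  All suprema and infima below are those of \<^typ>\<open>real\<close>, which are unspecified on empty or unbounded
  sets. For convex bodies in \<open>X \<noteq> {0}\<close> every set involved is nonempty and bounded on the
  relevant side, so they are the true suprema and infima.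
\<close>

definition convex_body :: "'a::real_normed_vector set \<Rightarrow> bool" where
  "convex_body K \<longleftrightarrow> bounded K \<and> closed K \<and> convex K \<and> interior K \<noteq> {}"

definition support_fun :: "'a::real_normed_vector set \<Rightarrow> ('a \<Rightarrow>\<^sub>L real) \<Rightarrow> real" where
  "support_fun K v = (SUP x\<in>K. blinfun_apply v x)"

definition dir_width :: "'a::real_normed_vector set \<Rightarrow> ('a \<Rightarrow>\<^sub>L real) \<Rightarrow> real" where
  "dir_width K v = support_fun K v + support_fun K (- v)"

definition body_width :: "'a::real_normed_vector set \<Rightarrow> real" where
  "body_width K = (INF v\<in>sphere 0 1. dir_width K v)"

text \<open>This is \<open>D(K)\<close>: a radius about the origin (possibly not attained), not the diameter.\<close>

definition max_norm :: "'a::real_normed_vector set \<Rightarrow> real" where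
  "max_norm K = (SUP x\<in>K. norm x)"

definition hausdorff_distance :: "'a::real_normed_vector set \<Rightarrow> 'a set \<Rightarrow> real" where
  "hausdorff_distance K M =
     max (SUP x\<in>K. INF y\<in>M. norm (x - y)) (SUP y\<in>M. INF x\<in>K. norm (x - y))"

definition scaled_layer :: "real \<Rightarrow> 'a::real_normed_vector set \<Rightarrow> ('a \<Rightarrow>\<^sub>L real) \<Rightarrow> 'a set" where
  "scaled_layer l K v =
     (let r = - support_fun K (- v); s = support_fun K v in
      {x. (l + 1) / 2 * r - (l - 1) / 2 * s \<le> blinfun_apply v x \<and>
          blinfun_apply v x \<le> (l + 1) / 2 * s - (l - 1) / 2 * r})"

definition scaled_body :: "real \<Rightarrow> 'a::real_normed_vector set \<Rightarrow> 'a set" where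
  "scaled_body l K = (\<Inter>v\<in>sphere 0 1. scaled_layer l K v)"

definition gen_minkowski :: "'a::real_normed_vector set \<Rightarrow> 'a \<Rightarrow> real" where
  "gen_minkowski K x = Inf {l. 0 \<le> l \<and> x \<in> scaled_body l K}"

end

theory Submission
  imports Defs
begin

text \<open>
  A layer \<open>L\<^sup>\<lambda>(K, v)\<close> is the slab between the two support hyperplanes of \<open>K\<close> given by \<open>v\<close>,
  dilated by \<open>\<lambda>\<close> about its central hyperplane. So \<open>x\<close> lies in it exactly when the distance of \<open>x\<close>
  from the central hyperplane, measured in half-widths of the slab, is at most \<open>\<lambda>\<close>. Writing
  \<open>g(K, v, x)\<close> for this ratio (\<open>layer_ratio\<close> below), \<open>\<alpha>(K, x)\<close> is the least common bound
  \<open>\<lambda> \<ge> 0\<close> of \<open>g(K, v, x)\<close> over all unit functionals \<open>v\<close>. Hence a bound on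
  \<open>\<bar>g(K, v, x) - g(M, v, y)\<bar>\<close> that is uniform in \<open>v\<close> is also a bound on
  \<open>\<bar>\<alpha>(K, x) - \<alpha>(M, y)\<bar>\<close> (lemma \<open>gen_minkowski_le_add\<close>).

  The uniform bound goes through \<open>g(K, v, y)\<close>. Moving the point from \<open>x\<close> to \<open>y\<close> changes the numerator
  of \<open>g\<close> by at most \<open>2 \<parallel>x - y\<parallel>\<close>, and the denominator is at least \<open>w(K)\<close>; this gives the second
  summand. Replacing \<open>K\<close> by \<open>M\<close> changes each support value by at most \<open>\<delta>(K, M)\<close>
  (lemma \<open>abs_support_fun_diff_le_hausdorff\<close>), so it changes both the numerator and the denominator by
  at most \<open>2 \<delta>(K, M)\<close>; the denominator stays at least \<open>w(K) - 2 \<delta>(K, M) > 0\<close>, and the numerator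
  for \<open>K\<close> is at most \<open>2 \<parallel>y\<parallel> + 2 D(K)\<close>. The perturbation estimate for quotients
  (lemma \<open>abs_diff_quotients_le\<close>) turns this into the first summand.
\<close>

section \<open>Support functions and widths of bounded sets\<close>

lemma abs_blinfun_apply_le_norm:
  fixes v :: "'a::real_normed_vector \<Rightarrow>\<^sub>L real"
  assumes "norm v \<le> 1"
  shows "\<bar>blinfun_apply v z\<bar> \<le> norm z"
proof -
  have "\<bar>blinfun_apply v z\<bar> \<le> norm v * norm z"
    using norm_blinfun[of v z] by simp
  also have "\<dots> \<le> norm z"
    using assms by (simp add: mult_left_le_one_le)
  finally show ?thesis .
qed

lemma norm_le_max_norm:
  assumes "bounded K" "z \<in> K"
  shows "norm z \<le> max_norm K"
  unfolding max_norm_def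
  using assms by (intro cSUP_upper bounded_imp_bdd_above) (auto simp: bounded_norm_comp)

lemma blinfun_apply_le_support_fun:
  assumes "bounded K" "z \<in> K"
  shows "blinfun_apply v z \<le> support_fun K v"
  unfolding support_fun_def
  using assms
  by (intro cSUP_upper bounded_imp_bdd_above bounded_linear_image blinfun.bounded_linear_right)

lemma abs_support_fun_le_max_norm:
  assumes K: "bounded K" "K \<noteq> {}" and v: "norm v \<le> 1"
  shows "\<bar>support_fun K v\<bar> \<le> max_norm K"
proof -
  have ub: "\<bar>blinfun_apply v z\<bar> \<le> max_norm K" if "z \<in> K" for z
    using abs_blinfun_apply_le_norm[OF v, of z] norm_le_max_norm[OF K(1) that] by linarith
  obtain z where z: "z \<in> K"
    using K(2) by auto
  have "support_fun K v \<le> max_norm K"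
    unfolding support_fun_def using ub K(2) by (intro cSUP_least) (auto simp: abs_le_iff)
  moreover have "- max_norm K \<le> support_fun K v"
    using ub[OF z] blinfun_apply_le_support_fun[OF K(1) z, of v] by linarith
  ultimately show ?thesis
    by linarith
qed

lemma dir_width_nonneg:
  assumes "bounded K" "K \<noteq> {}"
  shows "0 \<le> dir_width K v"
proof -
  obtain z where z: "z \<in> K"
    using assms(2) by auto
  show ?thesis
    unfolding dir_width_def
    using blinfun_apply_le_support_fun[OF assms(1) z, of v]
      blinfun_apply_le_support_fun[OF assms(1) z, of "- v"]
    by (simp add: blinfun.minus_left)
qed

lemma body_width_le_dir_width:
  assumes "bounded K" "K \<noteq> {}" "norm v = 1"
  shows "body_width K \<le> dir_width K v"
  unfolding body_width_def
  using assms by (intro cINF_lower bdd_belowI2[of _ 0] dir_width_nonneg) auto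

section \<open>Support functions and the Hausdorff distance\<close>

lemma hausdorff_distance_commute: "hausdorff_distance K M = hausdorff_distance M K"
  unfolding hausdorff_distance_def by (simp add: max.commute norm_minus_commute)

lemma bdd_below_norm_diff: "bdd_below ((\<lambda>y. norm (x - y)) ` M)"
  by (rule bdd_belowI2[of _ 0]) simp

lemma inf_dist_le_hausdorff_distance:
  assumes "bounded K" "M \<noteq> {}" "x \<in> K"
  shows "(INF y\<in>M. norm (x - y)) \<le> hausdorff_distance K M"
proof -
  obtain y0 where y0: "y0 \<in> M"
    using assms(2) by auto
  have "bdd_above ((\<lambda>x. INF y\<in>M. norm (x - y)) ` K)"
  proof (rule bdd_aboveI2)
    fix z assume "z \<in> K"
    have "(INF y\<in>M. norm (z - y)) \<le> norm (z - y0)"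
      by (rule cINF_lower[OF bdd_below_norm_diff y0])
    also have "\<dots> \<le> norm z + norm y0"
      by (rule norm_triangle_ineq4)
    also have "\<dots> \<le> max_norm K + norm y0"
      using norm_le_max_norm[OF assms(1) \<open>z \<in> K\<close>] by simp
    finally show "(INF y\<in>M. norm (z - y)) \<le> max_norm K + norm y0" .
  qed
  then have "(INF y\<in>M. norm (x - y)) \<le> (SUP x\<in>K. INF y\<in>M. norm (x - y))"
    using assms(3) by (rule cSUP_upper2) simp
  then show ?thesis
    unfolding hausdorff_distance_def by simp
qed

lemma hausdorff_distance_nonneg:
  assumes "bounded K" "K \<noteq> {}" "M \<noteq> {}"
  shows "0 \<le> hausdorff_distance K M"
proof -
  obtain x where x: "x \<in> K"
    using assms(2) by auto
  have "0 \<le> (INF y\<in>M. norm (x - y))"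
    using assms(3) by (rule cINF_greatest) simp
  then show ?thesis
    using inf_dist_le_hausdorff_distance[OF assms(1,3) x] by linarith
qed

lemma support_fun_le_add_hausdorff:
  assumes K: "bounded K" "K \<noteq> {}" and M: "bounded M" "M \<noteq> {}" and v: "norm v \<le> 1"
  shows "support_fun K v \<le> support_fun M v + hausdorff_distance K M"
  unfolding support_fun_def[of K]
proof (rule cSUP_least[OF K(2)])
  fix x assume x: "x \<in> K"
  have "blinfun_apply v x - support_fun M v \<le> (INF y\<in>M. norm (x - y))"
  proof (rule cINF_greatest[OF M(2)])
    fix y assume "y \<in> M"
    have "blinfun_apply v x - blinfun_apply v y \<le> norm (x - y)"
      using abs_blinfun_apply_le_norm[OF v, of "x - y"] by (simp add: blinfun.diff_right)
    then show "blinfun_apply v x - support_fun M v \<le> norm (x - y)"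
      using blinfun_apply_le_support_fun[OF M(1) \<open>y \<in> M\<close>, of v] by linarith
  qed
  then show "blinfun_apply v x \<le> support_fun M v + hausdorff_distance K M"
    using inf_dist_le_hausdorff_distance[OF K(1) M(2) x] by linarith
qed

text \<open>
  A functional of norm at most one is 1-Lipschitz, so points of \<open>K\<close> exceed the support value of \<open>M\<close>
  by at most their distance from \<open>M\<close>, and vice versa.
\<close>

lemma abs_support_fun_diff_le_hausdorff:
  assumes "bounded K" "K \<noteq> {}" "bounded M" "M \<noteq> {}" "norm v \<le> 1"
  shows "\<bar>support_fun K v - support_fun M v\<bar> \<le> hausdorff_distance K M"
  using support_fun_le_add_hausdorff[of K M v] support_fun_le_add_hausdorff[of M K v] assms
  by (simp add: hausdorff_distance_commute[of M K] abs_le_iff)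

section \<open>The generalized Minkowski functional as a least bound of ratios\<close>

text \<open>
  Numerator and denominator are twice the usual quantities: the central value of \<open>v\<close> on the slab is
  \<open>(h(K, v) - h(K, -v)) / 2\<close> and its half-width is \<open>w(K, v) / 2\<close>.
\<close>

definition central_offset ::
    "'a::real_normed_vector set \<Rightarrow> ('a \<Rightarrow>\<^sub>L real) \<Rightarrow> 'a \<Rightarrow> real" where
  "central_offset K v x = 2 * blinfun_apply v x - support_fun K v + support_fun K (- v)"

definition layer_ratio ::
    "'a::real_normed_vector set \<Rightarrow> ('a \<Rightarrow>\<^sub>L real) \<Rightarrow> 'a \<Rightarrow> real" where
  "layer_ratio K v x = \<bar>central_offset K v x\<bar> / dir_width K v"

lemma mem_scaled_layer_iff:
  assumes "0 < dir_width K v"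
  shows "x \<in> scaled_layer l K v \<longleftrightarrow> layer_ratio K v x \<le> l"
proof -
  have "x \<in> scaled_layer l K v \<longleftrightarrow> \<bar>central_offset K v x\<bar> \<le> l * dir_width K v"
    unfolding scaled_layer_def central_offset_def dir_width_def Let_def abs_le_iff
    by (auto simp: field_simps)
  then show ?thesis
    using assms by (simp add: layer_ratio_def pos_divide_le_eq)
qed

lemma mem_scaled_body_iff:
  assumes "\<And>v. norm v = 1 \<Longrightarrow> 0 < dir_width K v"
  shows "x \<in> scaled_body l K \<longleftrightarrow> (\<forall>v. norm v = 1 \<longrightarrow> layer_ratio K v x \<le> l)"
  using assms by (auto simp: scaled_body_def mem_scaled_layer_iff)

lemma abs_central_offset_le:
  assumes "bounded K" "K \<noteq> {}" "norm v \<le> 1"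
  shows "\<bar>central_offset K v x\<bar> \<le> 2 * norm x + 2 * max_norm K"
  using abs_support_fun_le_max_norm[OF assms] abs_blinfun_apply_le_norm[OF assms(3), of x]
    abs_support_fun_le_max_norm[of K "- v"] assms
  unfolding central_offset_def by simp

lemma layer_ratio_bounded:
  assumes "bounded K" "K \<noteq> {}" "norm v = 1" "0 < body_width K"
  shows "layer_ratio K v x \<le> (2 * norm x + 2 * max_norm K) / body_width K"
  unfolding layer_ratio_def
  using abs_central_offset_le[of K v x] body_width_le_dir_width[OF assms(1-3)] assms
  by (intro frac_le) auto

text \<open>
  The ratios for \<open>(K, x)\<close> are required to have some common bound \<open>B\<close> because the infimum defining
  \<open>gen_minkowski K x\<close> is meaningful only over a nonempty set.
\<close>

lemma gen_minkowski_le_add: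
  assumes posK: "\<And>v. norm v = 1 \<Longrightarrow> 0 < dir_width K v"
    and posM: "\<And>v. norm v = 1 \<Longrightarrow> 0 < dir_width M v"
    and bound: "\<And>v. norm v = 1 \<Longrightarrow> layer_ratio K v x \<le> B"
    and le: "\<And>v. norm v = 1 \<Longrightarrow> layer_ratio M v y \<le> layer_ratio K v x + e"
    and "0 \<le> e"
  shows "gen_minkowski M y \<le> gen_minkowski K x + e"
proof -
  let ?A = "{l. 0 \<le> l \<and> x \<in> scaled_body l K}"
  have "max 0 B \<in> ?A"
    using bound by (auto simp: mem_scaled_body_iff[OF posK] le_max_iff_disj)
  then have "?A \<noteq> {}"
    by blast
  then have "gen_minkowski M y - e \<le> Inf ?A"
  proof (rule cInf_greatest)
    fix l assume l: "l \<in> ?A"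
    have "layer_ratio M v y \<le> l + e" if "norm v = 1" for v
      using le[OF that] l that by (force simp: mem_scaled_body_iff[OF posK])
    then have "l + e \<in> {l. 0 \<le> l \<and> y \<in> scaled_body l M}"
      using l \<open>0 \<le> e\<close> by (simp add: mem_scaled_body_iff[OF posM])
    then have "gen_minkowski M y \<le> l + e"
      unfolding gen_minkowski_def by (rule cInf_lower) (auto intro: bdd_belowI[of _ 0])
    then show "gen_minkowski M y - e \<le> l"
      by simp
  qed
  then show ?thesis
    unfolding gen_minkowski_def by simp
qed

section \<open>Stability of the ratios\<close>

text \<open>
  With \<open>a / b\<close> the reference quotient and \<open>c / d\<close> its perturbation,
  \<open>a / b - c / d = (a (d - b) + b (a - c)) / (b d)\<close>. In the second term \<open>b\<close> cancels before the lower
  bound on \<open>b\<close> is used, so that no upper bound on \<open>b\<close> enters.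
\<close>

lemma abs_diff_quotients_le:
  fixes a b c d :: real
  assumes "\<bar>a - c\<bar> \<le> t" "\<bar>b - d\<bar> \<le> t" "\<bar>a\<bar> \<le> A" "0 < W" "W \<le> b" "t < W"
  shows "\<bar>a / b - c / d\<bar> \<le> t * (A + W) / (W * (W - t))"
proof -
  have pos: "0 < b" "0 < d" "W - t \<le> d" "0 < W - t" "0 \<le> t" "0 \<le> A"
    using assms by linarith+
  have "a / b - c / d = a * (d - b) / (b * d) + (a - c) / d"
    using pos by (simp add: field_simps)
  also have "\<bar>\<dots>\<bar> \<le> \<bar>a * (d - b) / (b * d)\<bar> + \<bar>(a - c) / d\<bar>"
    by (rule abs_triangle_ineq)
  also have "\<dots> = \<bar>a\<bar> * \<bar>d - b\<bar> / (b * d) + \<bar>a - c\<bar> / d"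
    using pos by (simp add: abs_mult)
  also have "\<dots> \<le> A * t / (W * (W - t)) + t / (W - t)"
  proof (rule add_mono)
    show "\<bar>a\<bar> * \<bar>d - b\<bar> / (b * d) \<le> A * t / (W * (W - t))"
      using assms pos by (intro frac_le mult_mono mult_nonneg_nonneg mult_pos_pos) auto
    show "\<bar>a - c\<bar> / d \<le> t / (W - t)"
      using assms pos by (intro frac_le) auto
  qed
  also have "t / (W - t) = t * W / (W * (W - t))"
    using assms by simp
  also have "A * t / (W * (W - t)) + \<dots> = t * (A + W) / (W * (W - t))"
    unfolding add_divide_distrib[symmetric] by (simp add: algebra_simps)
  finally show ?thesis .
qed

lemma layer_ratio_change_point:
  assumes "bounded K" "K \<noteq> {}" "norm v = 1" "0 < body_width K"
  shows "\<bar>layer_ratio K v x - layer_ratio K v y\<bar> \<le> 2 * norm (x - y) / body_width K"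
proof -
  have w: "body_width K \<le> dir_width K v"
    by (rule body_width_le_dir_width[OF assms(1-3)])
  have "\<bar>\<bar>central_offset K v x\<bar> - \<bar>central_offset K v y\<bar>\<bar>
      \<le> \<bar>central_offset K v x - central_offset K v y\<bar>"
    by (rule abs_triangle_ineq3)
  also have "central_offset K v x - central_offset K v y = 2 * blinfun_apply v (x - y)"
    by (simp add: central_offset_def blinfun.diff_right algebra_simps)
  also have "\<bar>\<dots>\<bar> = 2 * \<bar>blinfun_apply v (x - y)\<bar>"
    by (simp add: abs_mult)
  also have "\<dots> \<le> 2 * norm (x - y)"
    using abs_blinfun_apply_le_norm[of v "x - y"] assms(3) by simp
  finally have num:
    "\<bar>\<bar>central_offset K v x\<bar> - \<bar>central_offset K v y\<bar>\<bar> \<le> 2 * norm (x - y)" .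
  have "\<bar>layer_ratio K v x - layer_ratio K v y\<bar>
      = \<bar>\<bar>central_offset K v x\<bar> - \<bar>central_offset K v y\<bar>\<bar> / dir_width K v"
    using w assms(4) by (simp add: layer_ratio_def flip: diff_divide_distrib)
  also have "\<dots> \<le> 2 * norm (x - y) / body_width K"
    using num w assms(4) by (intro frac_le) auto
  finally show ?thesis .
qed

lemma abs_dir_width_diff_le_hausdorff:
  assumes "bounded K" "K \<noteq> {}" "bounded M" "M \<noteq> {}" "norm v \<le> 1"
  shows "\<bar>dir_width K v - dir_width M v\<bar> \<le> 2 * hausdorff_distance K M"
  using abs_support_fun_diff_le_hausdorff[OF assms]
    abs_support_fun_diff_le_hausdorff[OF assms(1-4), of "- v"] assms(5)
  unfolding dir_width_def by simp

lemma layer_ratio_change_body: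
  assumes K: "bounded K" "K \<noteq> {}" and M: "bounded M" "M \<noteq> {}" and v: "norm v = 1"
    and pos: "0 < body_width K" and close: "2 * hausdorff_distance K M < body_width K"
  shows "\<bar>layer_ratio K v y - layer_ratio M v y\<bar>
    \<le> 2 * hausdorff_distance K M * (2 * norm y + 2 * max_norm K + body_width K)
        / (body_width K * (body_width K - 2 * hausdorff_distance K M))"
  unfolding layer_ratio_def
proof (rule abs_diff_quotients_le[OF _ _ _ pos _ close])
  have v': "norm v \<le> 1" "norm (- v) \<le> 1"
    using v by auto
  show "\<bar>\<bar>central_offset K v y\<bar> - \<bar>central_offset M v y\<bar>\<bar> \<le> 2 * hausdorff_distance K M"
    using abs_support_fun_diff_le_hausdorff[OF K M v'(1)]
      abs_support_fun_diff_le_hausdorff[OF K M v'(2)]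
    unfolding central_offset_def by linarith
  show "\<bar>dir_width K v - dir_width M v\<bar> \<le> 2 * hausdorff_distance K M"
    by (rule abs_dir_width_diff_le_hausdorff[OF K M v'(1)])
  show "\<bar>\<bar>central_offset K v y\<bar>\<bar> \<le> 2 * norm y + 2 * max_norm K"
    using abs_central_offset_le[OF K v'(1)] by simp
  show "body_width K \<le> dir_width K v"
    by (rule body_width_le_dir_width[OF K v])
qed

section \<open>Stability of the generalized Minkowski functional\<close>

theorem theorem5p5:
  fixes K M :: "'a::real_normed_vector set" and x y :: 'a
  assumes "(UNIV :: 'a set) \<noteq> {0}"
    and "convex_body K"
    and "convex_body M"
    and "hausdorff_distance K M < 1 / 2 * body_width K"
  shows "\<bar>gen_minkowski K x - gen_minkowski M y\<bar>
    \<le> hausdorff_distance K M * (4 * norm y + 4 * max_norm K + 2 * body_width K)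
        / (body_width K * (body_width K - 2 * hausdorff_distance K M))
      + 2 * norm (x - y) / body_width K"
    (is "_ \<le> ?e")
proof -
  have K: "bounded K" "K \<noteq> {}" and M: "bounded M" "M \<noteq> {}"
    using assms(2,3) by (auto simp: convex_body_def)
  have "0 \<le> hausdorff_distance K M"
    by (rule hausdorff_distance_nonneg[OF K M(2)])
  moreover have close: "2 * hausdorff_distance K M < body_width K"
    using assms(4) by simp
  ultimately have pos: "0 < body_width K"
    by linarith
  have posK: "0 < dir_width K v" if "norm v = 1" for v
    using body_width_le_dir_width[OF K that] pos by linarith
  have posM: "0 < dir_width M v" if "norm v = 1" for v
    using body_width_le_dir_width[OF K that] close
      abs_dir_width_diff_le_hausdorff[OF K M, of v] that by linarith
  have ratio: "\<bar>layer_ratio K v x - layer_ratio M v y\<bar> \<le> ?e" if v: "norm v = 1" for v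
  proof -
    have "2 * hausdorff_distance K M * (2 * norm y + 2 * max_norm K + body_width K)
        = hausdorff_distance K M * (4 * norm y + 4 * max_norm K + 2 * body_width K)"
      by (simp add: algebra_simps)
    from layer_ratio_change_body[OF K M v pos close, of y, unfolded this]
      layer_ratio_change_point[OF K v pos, of x y]
    show ?thesis
      by linarith
  qed
  have "0 \<le> max_norm K"
    using K norm_le_max_norm[OF K(1)] norm_ge_zero order_trans by blast
  then have e: "0 \<le> ?e"
    using pos close \<open>0 \<le> hausdorff_distance K M\<close>
    by (intro add_nonneg_nonneg divide_nonneg_nonneg mult_nonneg_nonneg) auto
  let ?B = "(2 * norm x + 2 * max_norm K) / body_width K"
  have boundK: "layer_ratio K v x \<le> ?B" if "norm v = 1" for v
    by (rule layer_ratio_bounded[OF K that pos])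
  have boundM: "layer_ratio M v y \<le> ?B + ?e" if "norm v = 1" for v
    using boundK[OF that] ratio[OF that] by linarith
  have le: "layer_ratio M v y \<le> layer_ratio K v x + ?e" "layer_ratio K v x \<le> layer_ratio M v y + ?e"
    if "norm v = 1" for v
    using ratio[OF that] by linarith+
  have "gen_minkowski M y \<le> gen_minkowski K x + ?e"
    by (rule gen_minkowski_le_add[OF posK posM boundK le(1) e])
  moreover have "gen_minkowski K x \<le> gen_minkowski M y + ?e"
    by (rule gen_minkowski_le_add[OF posM posK boundM le(2) e])
  ultimately show ?thesis
    by linarith
qed

end
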